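(* Suppose that $(S,\circ)$ is a graded anti-pre-Lie algebraic structure on the Witt algebra $\mathcal{W}$, with $W_m\circ W_n=\varphi(m,n)W_{m+n}$ for all $m,n\in\mathbb{Z}$. Define a linear map $\rho:\mathcal{W}\to\mathfrak{gl}(S)$ by $$\rho(W_m)W_n=-W_m\circ W_n=-\varphi(m,n)W_{m+n},\qquad\forall m,n\in\mathbb{Z}.$$ Then $(\rho,S)$ is a weight representation of $\mathcal{W}$ in which each nonzero weight space is one-dimensional.
   Context: All vector spaces and algebras are over $\mathbb{C}$. An anti-pre-Lie algebra is a vector space $A$ with a bilinear operation $\circ$ such that, with $[x,y]=x\circ y-y\circ x$, for all $x,y,z\in A$: $x\circ(y\circ z)-y\circ(x\circ z)=[y,x]\circ z$ and $[[x,y],z]+[[y,z],x]+[[z,x],y]=0$. The commutator $[\cdot,\cdot]$ then is a Lie bracket on $A$, and $(A,\circ)$ is called an anti-pre-Lie algebraic structure on a Lie algebra $\mathfrak{g}$ if the underlying vector space of $\mathfrak g$ is $A$ and the Lie bracket of $\mathfrak g$ is this commutator. The Witt algebra $\mathcal{W}$ is the Lie algebra with basis $\{W_m : m\in\mathbb{Z}\}$ and bracket $[W_m,W_n]=(n-m)W_{m+n}$ for all $m,n\in\mathbb{Z}$. A graded anti-pre-Lie algebraic structure on $\mathcal{W}$, denoted $(S,\circ)$, is an anti-pre-Lie algebraic structure on $\mathcal{W}$ (so $S=\mathcal{W}$ as a vector space) such that $W_m\circ W_n=\varphi(m,n)W_{m+n}$ for all $m,n\in\mathbb{Z}$, for some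 function $\varphi:\mathbb{Z}\times\mathbb{Z}\to\mathbb{C}$. A representation $V$ of $\mathcal{W}$ is a weight representation if $V=\bigoplus_{\lambda\in\mathbb{C}}V_\lambda$ as vector spaces, where $V_\lambda=\{v\in V: W_0v=\lambda v\}$ is called a weight space. *)

theory Defs
  imports Complex_Main
begin

definition bilinear_map ::
  "(complex \<Rightarrow> 'a::ab_group_add \<Rightarrow> 'a) \<Rightarrow> (complex \<Rightarrow> 'b::ab_group_add \<Rightarrow> 'b) \<Rightarrow>
   (complex \<Rightarrow> 'c::ab_group_add \<Rightarrow> 'c) \<Rightarrow> ('a \<Rightarrow> 'b \<Rightarrow> 'c) \<Rightarrow> bool"
  where "bilinear_map s1 s2 s3 f \<longleftrightarrow>
    (\<forall>x. Vector_Spaces.linear s2 s3 (\<lambda>y. f x y)) \<and>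
    (\<forall>y. Vector_Spaces.linear s1 s3 (\<lambda>x. f x y))"

locale lie_algebra = vector_space scale
  for scale :: "complex \<Rightarrow> 'a::ab_group_add \<Rightarrow> 'a" +
  fixes bracket :: "'a \<Rightarrow> 'a \<Rightarrow> 'a"
  assumes bracket_bilinear: "bilinear_map scale scale scale bracket"
    and bracket_self: "bracket x x = 0"
    and jacobi: "bracket (bracket x y) z + bracket (bracket y z) x + bracket (bracket z x) y = 0"

definition commutator :: "('a::ab_group_add \<Rightarrow> 'a \<Rightarrow> 'a) \<Rightarrow> 'a \<Rightarrow> 'a \<Rightarrow> 'a"
  where "commutator circ x y = circ x y - circ y x"

locale anti_pre_lie_algebra = vector_space scale
  for scale :: "complex \<Rightarrow> 'a::ab_group_add \<Rightarrow> 'a" +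
  fixes circ :: "'a \<Rightarrow> 'a \<Rightarrow> 'a"
  assumes circ_bilinear: "bilinear_map scale scale scale circ"
    and anti_pre_lie: "circ x (circ y z) - circ y (circ x z) = circ (commutator circ y x) z"
    and commutator_jacobi:
      "commutator circ (commutator circ x y) z + commutator circ (commutator circ y z) x
        + commutator circ (commutator circ z x) y = 0"

locale anti_pre_lie_structure =
  lie_algebra scale bracket + anti_pre_lie_algebra scale circ
  for scale :: "complex \<Rightarrow> 'a::ab_group_add \<Rightarrow> 'a"
    and bracket circ :: "'a \<Rightarrow> 'a \<Rightarrow> 'a" +
  assumes bracket_eq_commutator: "bracket x y = commutator circ x y"

text \<open>
  The Witt algebra is given by its presentation: any complex Lie algebra together with a basis
  \<open>W\<close> indexed by the integers (injectivity keeps the indexed family, and not only its range,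
  linearly independent) and the prescribed structure constants.
\<close>

locale witt_algebra = lie_algebra scale bracket
  for scale :: "complex \<Rightarrow> 'a::ab_group_add \<Rightarrow> 'a"
    and bracket :: "'a \<Rightarrow> 'a \<Rightarrow> 'a" +
  fixes W :: "int \<Rightarrow> 'a"
  assumes W_inj: "inj W"
    and W_independent: "\<not> dependent (range W)"
    and W_span: "span (range W) = UNIV"
    and W_bracket: "bracket (W m) (W n) = scale (of_int (n - m)) (W (m + n))"

locale graded_anti_pre_lie_structure =
  witt_algebra scale bracket W + anti_pre_lie_structure scale bracket circ
  for scale :: "complex \<Rightarrow> 'a::ab_group_add \<Rightarrow> 'a"
    and bracket :: "'a \<Rightarrow> 'a \<Rightarrow> 'a" and W :: "int \<Rightarrow> 'a" and circ :: "'a \<Rightarrow> 'a \<Rightarrow> 'a" +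
  fixes \<phi> :: "int \<Rightarrow> int \<Rightarrow> complex"
  assumes circ_graded: "circ (W m) (W n) = scale (\<phi> m n) (W (m + n))"

text \<open>
  A map \<open>\<rho> :: 'g \<Rightarrow> 'v \<Rightarrow> 'v\<close> is a linear map into the endomorphisms of \<open>'v\<close> iff it is bilinear
  in its curried arguments.
\<close>

locale lie_representation = lie_algebra scale bracket + V: vector_space scaleV
  for scale :: "complex \<Rightarrow> 'g::ab_group_add \<Rightarrow> 'g"
    and bracket :: "'g \<Rightarrow> 'g \<Rightarrow> 'g"
    and scaleV :: "complex \<Rightarrow> 'v::ab_group_add \<Rightarrow> 'v" +
  fixes \<rho> :: "'g \<Rightarrow> 'v \<Rightarrow> 'v"
  assumes rep_bilinear: "bilinear_map scale scaleV scaleV \<rho>"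
    and rep_bracket: "\<rho> (bracket x y) v = \<rho> x (\<rho> y v) - \<rho> y (\<rho> x v)"

definition weight_space ::
  "(int \<Rightarrow> 'g) \<Rightarrow> (complex \<Rightarrow> 'v \<Rightarrow> 'v) \<Rightarrow> ('g \<Rightarrow> 'v \<Rightarrow> 'v) \<Rightarrow> complex \<Rightarrow> 'v set"
  where "weight_space W scaleV \<rho> \<mu> = {v. \<rho> (W 0) v = scaleV \<mu> v}"

text \<open>
  Internal direct sum of a family of subspaces: every vector has exactly one decomposition into
  finitely many nonzero components.
\<close>

definition is_direct_sum :: "('i \<Rightarrow> 'v::ab_group_add set) \<Rightarrow> bool"
  where "is_direct_sum U \<longleftrightarrow>
    (\<forall>v. \<exists>!f. (\<forall>i. f i \<in> U i) \<and> finite {i. f i \<noteq> 0} \<and> v = (\<Sum>i\<in>{i. f i \<noteq> 0}. f i))"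

locale witt_weight_representation =
  witt_algebra scale bracket W + lie_representation scale bracket scaleV \<rho>
  for scale :: "complex \<Rightarrow> 'g::ab_group_add \<Rightarrow> 'g"
    and bracket :: "'g \<Rightarrow> 'g \<Rightarrow> 'g" and W :: "int \<Rightarrow> 'g"
    and scaleV :: "complex \<Rightarrow> 'v::ab_group_add \<Rightarrow> 'v"
    and \<rho> :: "'g \<Rightarrow> 'v \<Rightarrow> 'v" +
  assumes weight_decomposition: "is_direct_sum (weight_space W scaleV \<rho>)"

end

theory Submission
  imports Defs
begin

text \<open>
  Comparing coefficients with \<open>x = W 0\<close> in the anti-pre-Lie identity shows that
  \<open>g n = \<phi> 0 n + n\<close> satisfies \<open>g (n + k) = g k\<close> whenever \<open>\<phi> n k \<noteq> 0\<close>. Since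
  \<open>\<phi> n k - \<phi> k n = k - n\<close>, at least one of \<open>\<phi> n k\<close>, \<open>\<phi> k n\<close> is nonzero for \<open>n \<noteq> k\<close>, and
  taking \<open>k = 0\<close> gives \<open>g n \<in> {2 n, g 0}\<close>. If \<open>g s \<noteq> g 0\<close>, any splitting \<open>s = n + k\<close> into
  distinct nonzero \<open>n, k\<close> would force \<open>2 s \<in> {2 n, 2 k}\<close>, which is absurd. Hence
  \<open>\<rho> (W 0)\<close> is diagonal in the basis \<open>W\<close> with the distinct eigenvalues \<open>n - \<phi> 0 0\<close>.
\<close>

section \<open>Operators that are diagonal in an integer-indexed or arbitrary basis, and their
  eigenspaces\<close>

context vector_space
begin

text \<open>Both sides are linear in \<open>v\<close>, so induction over the span reduces to basis
  vectors. This turns the eigenvector equation into one scalar equation per coordinate.\<close>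

lemma representation_diagonal:
  assumes W: "inj W" "independent (range W)" "span (range W) = UNIV"
    and T: "Vector_Spaces.linear scale scale T"
    and diag: "\<And>i. T (W i) = scale (l i) (W i)"
  shows "representation (range W) (T v) (W i) = l i * representation (range W) v (W i)"
proof -
  interpret T: Vector_Spaces.linear scale scale T by (rule T)
  have "v \<in> span (range W)" using W(3) by simp
  then show ?thesis
  proof (induction rule: span_induct_alt)
    case base
    show ?case by (simp add: T.zero representation_zero)
  next
    case (step c x y)
    then obtain j where x: "x = W j" by auto
    show ?case
      using step.IH W injD[OF W(1)]
      by (auto simp: x T.add T.scale diag representation_add representation_scale
          representation_basis span_base algebra_simps)
  qed
qed

text \<open>An eigenvector for \<open>m\<close> can have a nonzero coordinate at \<open>W j\<close>
  only if \<open>l j = m\<close>, and injectivity of \<open>l\<close> allows at most one such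
  \<open>j\<close>.\<close>

lemma eigenspace_diagonal:
  assumes W: "inj W" "independent (range W)" "span (range W) = UNIV"
    and T: "Vector_Spaces.linear scale scale T"
    and diag: "\<And>i. T (W i) = scale (l i) (W i)" and l: "inj l"
  shows "{v. T v = scale (l i) v} = span {W i}"
    and "m \<notin> range l \<Longrightarrow> {v. T v = scale m v} = {0}"
proof -
  interpret T: Vector_Spaces.linear scale scale T by (rule T)
  have coord: "representation (range W) v (W j) = 0" if "T v = scale m v" "l j \<noteq> m" for v m j
    using representation_diagonal[OF W T diag, of v j] that W
    by (simp add: representation_scale)
  \<comment> \<open>This serves both claims: \<open>i\<close> is either the index with
    \<open>l i = m\<close> or, when \<open>m\<close> is not in \<open>range l\<close>, an arbitrary
    index.\<close>
  have *: "v = scale (representation (range W) v (W i)) (W i)"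
    if "T v = scale m v" "\<And>j. j \<noteq> i \<Longrightarrow> l j \<noteq> m" for v m i
  proof -
    have "v = (\<Sum>b | representation (range W) v b \<noteq> 0. scale (representation (range W) v b) b)"
      using W by (simp add: sum_nonzero_representation_eq)
    also have "\<dots> = (\<Sum>b\<in>{W i}. scale (representation (range W) v b) b)"
    proof (rule sum.mono_neutral_left)
      show "{b. representation (range W) v b \<noteq> 0} \<subseteq> {W i}"
      proof
        fix b assume "b \<in> {b. representation (range W) v b \<noteq> 0}"
        then have b: "representation (range W) v b \<noteq> 0" by simp
        then obtain j where "b = W j" using representation_ne_zero by blast
        with b coord[OF that(1), of j] that(2)[of j] show "b \<in> {W i}" by auto
      qed
    qed auto
    finally show ?thesis by simp
  qed
  show "{v. T v = scale (l i) v} = span {W i}"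
  proof (intro equalityI subsetI)
    fix v assume "v \<in> {v. T v = scale (l i) v}"
    then show "v \<in> span {W i}"
      using *[of v "l i" i] l by (metis (mono_tags, lifting) injD mem_Collect_eq span_base span_scale singletonI)
  next
    fix v assume "v \<in> span {W i}"
    then show "v \<in> {v. T v = scale (l i) v}"
      by (auto simp: span_singleton T.scale diag mult.commute)
  qed
  show "{v. T v = scale m v} = {0}" if "m \<notin> range l"
  proof (intro equalityI subsetI)
    fix v assume "v \<in> {v. T v = scale m v}"
    then have v: "T v = scale m v" by simp
    have ne: "l j \<noteq> m" for j using that by auto
    show "v \<in> {0}"
      \<comment> \<open>Any index would do: \<open>v\<close> is a multiple of that basis vector, and
        its coordinate there vanishes.\<close>
      using *[OF v ne, of undefined] coord[OF v ne, of undefined] by simp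
  qed (simp add: T.zero)
qed

text \<open>Existence relabels the basis expansion of \<open>v\<close> by eigenvalues; uniqueness
  compares coordinates.\<close>

lemma is_direct_sum_eigenspaces_diagonal:
  assumes W: "inj W" "independent (range W)" "span (range W) = UNIV"
    and T: "Vector_Spaces.linear scale scale T"
    and diag: "\<And>i. T (W i) = scale (l i) (W i)" and l: "inj l"
  shows "is_direct_sum (\<lambda>m. {v. T v = scale m v})"
  unfolding is_direct_sum_def
proof
  fix v
  let ?r = "representation (range W)"
  note eig = eigenspace_diagonal[OF assms]
  \<comment> \<open>Off \<open>range l\<close> the eigenspace is trivial, so the component there has
    to be 0.\<close>
  define f where "f m = (if m \<in> range l then scale (?r v (W (inv l m))) (W (inv l m)) else 0)" for m
  have fl: "f (l i) = scale (?r v (W i)) (W i)" for i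
    using l by (simp add: f_def)
  have W0: "W i \<noteq> 0" for i
    using W(2) dependent_zero by (metis rangeI)
  let ?I = "{i. ?r v (W i) \<noteq> 0}"
  have img: "W ` ?I = {b. ?r v b \<noteq> 0}"
  proof -
    have "{b. ?r v b \<noteq> 0} \<subseteq> range W" by (auto dest: representation_ne_zero)
    then show ?thesis by blast
  qed
  have fin: "finite ?I"
    using finite_imageD[of W ?I] img finite_representation[of "range W" v] W(1)
    by (simp add: inj_on_subset[OF W(1)])
  have supp: "{m. f m \<noteq> 0} = l ` ?I"
  proof -
    have "{m. f m \<noteq> 0} \<subseteq> range l" by (auto simp: f_def)
    then have "{m. f m \<noteq> 0} = l ` {i. f (l i) \<noteq> 0}" by blast
    then show ?thesis by (simp add: fl W0)
  qed
  show "\<exists>!f. (\<forall>m. f m \<in> {v. T v = scale m v}) \<and> finite {m. f m \<noteq> 0} \<and> v = (\<Sum>m | f m \<noteq> 0. f m)"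
  proof (rule ex1I[of _ f], intro conjI allI)
    show "f m \<in> {v. T v = scale m v}" for m
    proof (cases "m \<in> range l")
      case True
      then obtain i where m: "m = l i" by auto
      have "f m \<in> span {W i}" by (simp add: m fl span_scale span_base)
      then show ?thesis using eig(1)[of i] by (simp only: m)
    next
      case False
      then show ?thesis using eig(2)[OF False] by (simp only: f_def if_False singletonI)
    qed
    show "finite {m. f m \<noteq> 0}" using supp fin by simp
    have "v = (\<Sum>b\<in>W ` ?I. scale (?r v b) b)"
      unfolding img using W by (simp add: sum_nonzero_representation_eq)
    also have "\<dots> = (\<Sum>i\<in>?I. f (l i))"
      using inj_on_subset[OF W(1)] by (simp add: sum.reindex fl)
    also have "\<dots> = (\<Sum>m | f m \<noteq> 0. f m)"
      unfolding supp using inj_on_subset[OF l] by (simp add: sum.reindex)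
    finally show "v = (\<Sum>m | f m \<noteq> 0. f m)" .
  next
    fix g assume g: "(\<forall>m. g m \<in> {v. T v = scale m v}) \<and> finite {m. g m \<noteq> 0} \<and>
      v = (\<Sum>m | g m \<noteq> 0. g m)"
    then have v: "v = (\<Sum>m | g m \<noteq> 0. g m)" by blast
    have gl: "\<exists>c. g (l i) = scale c (W i)" for i
      using g eig(1)[of i] unfolding span_singleton by blast
    have g0: "g m = 0" if "m \<notin> range l" for m
      using g eig(2)[OF that] by blast
    \<comment> \<open>Only the component \<open>g (l i)\<close> contributes to the
      \<open>W i\<close>-coordinate of \<open>v\<close>, which determines that component.\<close>
    have off: "?r (g m) (W i) = 0" if "m \<noteq> l i" for m i
    proof (cases "m \<in> range l")
      case True
      then obtain j where j: "m = l j" by auto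
      obtain c where "g m = scale c (W j)" using gl j by auto
      then show ?thesis
        using that j W injD[OF W(1)]
        by (auto simp: representation_scale representation_basis)
    qed (simp add: g0 representation_zero)
    have "g (l i) = f (l i)" for i
    proof -
      obtain c where c: "g (l i) = scale c (W i)" using gl by auto
      have "?r v (W i) = (\<Sum>m | g m \<noteq> 0. ?r (g m) (W i))"
        by (subst v, subst representation_sum) (use W in auto)
      also have "\<dots> = (\<Sum>m | g m \<noteq> 0. if m = l i then ?r (g m) (W i) else 0)"
        by (intro sum.cong refl) (simp add: off)
      \<comment> \<open>If \<open>g (l i) = 0\<close>, then \<open>l i\<close> is missing from the
        index set, but both sides are 0.\<close>
      also have "\<dots> = ?r (g (l i)) (W i)"
        using g by (simp add: representation_zero)
      also have "\<dots> = c"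
        using W by (simp add: c representation_scale representation_basis)
      finally show ?thesis by (simp add: c fl)
    qed
    then show "g = f"
      using g0 by (metis (no_types, opaque_lifting) ext f_def imageE)
  qed
qed

end

section \<open>Identities for the structure coefficients \<phi>\<close>

context graded_anti_pre_lie_structure
begin

lemma W_nonzero: "W n \<noteq> 0"
  using W_independent dependent_zero by (metis rangeI)

lemma scale_W_cancel: "scale a (W n) = scale b (W n) \<longleftrightarrow> a = b"
  by (simp add: scale_cancel_right W_nonzero)

lemma circ_scale_right: "circ x (scale c y) = scale c (circ x y)"
proof -
  interpret vector_space_pair scale scale ..
  show ?thesis using circ_bilinear linear_scale by (fastforce simp: bilinear_map_def)
qed

lemma circ_scale_left: "circ (scale c x) y = scale c (circ x y)"
proof -
  interpret vector_space_pair scale scale ..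
  show ?thesis using circ_bilinear linear_scale by (fastforce simp: bilinear_map_def)
qed

lemma phi_commutator: "\<phi> m n - \<phi> n m = of_int (n - m)"
proof -
  have "scale (\<phi> m n - \<phi> n m) (W (m + n)) = scale (of_int (n - m)) (W (m + n))"
    using W_bracket[of m n] bracket_eq_commutator[of "W m" "W n"]
    by (simp add: commutator_def circ_graded scale_left_diff_distrib add.commute)
  then show ?thesis by (simp only: scale_W_cancel)
qed

lemma phi_anti_pre_lie:
  "\<phi> n k * \<phi> m (n + k) - \<phi> m k * \<phi> n (m + k) = of_int (m - n) * \<phi> (m + n) k"
proof -
  have "scale (\<phi> n k * \<phi> m (n + k) - \<phi> m k * \<phi> n (m + k)) (W (m + n + k))
      = circ (W m) (circ (W n) (W k)) - circ (W n) (circ (W m) (W k))"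
    by (simp add: circ_graded circ_scale_right scale_left_diff_distrib add.assoc add.left_commute)
  also have "\<dots> = circ (bracket (W n) (W m)) (W k)"
    by (simp add: anti_pre_lie bracket_eq_commutator)
  also have "\<dots> = scale (of_int (m - n) * \<phi> (m + n) k) (W (m + n + k))"
    by (simp add: W_bracket circ_scale_left circ_graded add.commute)
  finally show ?thesis by (simp only: scale_W_cancel)
qed

text \<open>In the coefficient identity with \<open>m = 0\<close>, every term carries the factor
  \<open>\<phi> n k\<close>, which cancels.\<close>

lemma phi_zero_shift:
  assumes "\<phi> n k \<noteq> 0"
  shows "\<phi> 0 (n + k) = \<phi> 0 k - of_int n"
proof -
  have "\<phi> n k * (\<phi> 0 (n + k) - \<phi> 0 k + of_int n) = 0"
    using phi_anti_pre_lie[of n k 0] by (simp add: algebra_simps)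
  then have "\<phi> 0 (n + k) - \<phi> 0 k + of_int n = 0" using assms by simp
  then show ?thesis by (simp add: algebra_simps add_eq_0_iff)
qed

lemma phi_zero_left: "\<phi> 0 n = \<phi> 0 0 - of_int n"
proof -
  define g where "g k = \<phi> 0 k + of_int k" for k
  \<comment> \<open>If \<open>\<phi> k 0 = 0\<close>, the commutator relation gives
    \<open>\<phi> 0 k = k\<close>; otherwise the shift rule applies.\<close>
  have g_cases: "g k = 2 * of_int k \<or> g k = g 0" for k
    using phi_zero_shift[of k 0] phi_commutator[of 0 k]
    by (cases "\<phi> k 0 = 0") (auto simp: g_def)
  have g_add: "g (i + k) = g i \<or> g (i + k) = g k" if "i \<noteq> k" for i k
  proof -
    have "of_int (k - i) \<noteq> (0 :: complex)" using that by (simp only: of_int_eq_0_iff)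
    then have "\<phi> i k \<noteq> 0 \<or> \<phi> k i \<noteq> 0" using phi_commutator[of i k] by auto
    then show ?thesis
      using phi_zero_shift[of i k] phi_zero_shift[of k i] by (auto simp: g_def add.commute)
  qed
  \<comment> \<open>Split \<open>n = (n + j) + (- j)\<close>. As \<open>j\<close> exceeds the
    absolute value of \<open>n\<close>, the summands have opposite signs and both differ from
    \<open>n\<close>.\<close>
  define j where "j = \<bar>n\<bar> + 1"
  have "g n = g (n + j) \<or> g n = g (- j)"
    using g_add[of "n + j" "- j"] by (auto simp: j_def)
  then have "g n = 2 * of_int (n + j) \<or> g n = 2 * of_int (- j) \<or> g n = g 0"
    using g_cases[of "n + j"] g_cases[of "- j"] by metis
  moreover have "of_int n \<noteq> (of_int (n + j) :: complex)" "of_int n \<noteq> (of_int (- j) :: complex)"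
    unfolding of_int_eq_iff by (auto simp: j_def)
  ultimately have "g n = g 0"
    using g_cases[of n] by auto
  then show ?thesis by (simp add: g_def algebra_simps)
qed

end

text \<open>Extend by linearity first in \<open>y\<close> with \<open>x\<close> in \<open>A\<close>
  fixed, then in \<open>x\<close>. It is needed because \<rho> is prescribed only on basis
  vectors.\<close>

lemma bilinear_map_eqI:
  assumes f: "bilinear_map s1 s2 s3 f" and g: "bilinear_map s1 s2 s3 g"
    and A: "module.span s1 A = UNIV" and B: "module.span s2 B = UNIV"
    and eq: "\<And>x y. x \<in> A \<Longrightarrow> y \<in> B \<Longrightarrow> f x y = g x y"
  shows "f x y = g x y"
proof -
  have lin: "Vector_Spaces.linear s2 s3 (h x)" "Vector_Spaces.linear s1 s3 (\<lambda>x. h x y)"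
    if "bilinear_map s1 s2 s3 h" for h x y
    using that by (auto simp: bilinear_map_def)
  interpret p1: vector_space_pair s1 s3
    using lin(2)[OF f] by (simp add: vector_space_pair_def Vector_Spaces.linear_def)
  interpret p2: vector_space_pair s2 s3
    using lin(1)[OF f] by (simp add: vector_space_pair_def Vector_Spaces.linear_def)
  have "f x y = g x y" if "x \<in> A" for x y
    using p2.linear_eq_on_span[OF lin(1)[OF f] lin(1)[OF g], of B x x y] eq that B by auto
  then show ?thesis
    using p1.linear_eq_on_span[OF lin(2)[OF f] lin(2)[OF g], of A y y x] A by auto
qed

theorem lemma3p5:
  fixes scale :: "complex \<Rightarrow> 'a::ab_group_add \<Rightarrow> 'a"
    and bracket circ :: "'a \<Rightarrow> 'a \<Rightarrow> 'a"
    and W :: "int \<Rightarrow> 'a"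
    and \<phi> :: "int \<Rightarrow> int \<Rightarrow> complex"
    and \<rho> :: "'a \<Rightarrow> 'a \<Rightarrow> 'a"
  assumes "graded_anti_pre_lie_structure scale bracket W circ \<phi>"
    and "bilinear_map scale scale scale \<rho>"
    and "\<And>m n. \<rho> (W m) (W n) = - circ (W m) (W n)"
  shows "witt_weight_representation scale bracket W scale \<rho> \<and>
    (\<forall>\<mu>. weight_space W scale \<rho> \<mu> \<noteq> {0} \<longrightarrow>
      vector_space.dim scale (weight_space W scale \<rho> \<mu>) = 1)"
proof -
  interpret graded_anti_pre_lie_structure scale bracket W circ \<phi> by (rule assms(1))
  interpret vsp: vector_space_pair scale scale ..
  have "bilinear_map scale scale scale (\<lambda>x y. - circ x y)"
    using circ_bilinear by (auto simp: bilinear_map_def intro: vsp.linear_compose_neg)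
  then have \<rho>: "\<rho> x y = - circ x y" for x y
    using bilinear_map_eqI[OF assms(2) _ W_span W_span] assms(3) by blast
  have circ_neg: "circ x (- y) = - circ x y" for x y
    using circ_bilinear by (simp add: bilinear_map_def vsp.linear_neg)
  \<comment> \<open>This is \<open>- \<phi> 0 n\<close> rewritten so that injectivity is
    evident.\<close>
  define l :: "int \<Rightarrow> complex" where "l n = of_int n - \<phi> 0 0" for n
  have l: "inj l" by (auto simp: l_def inj_def)
  have lin: "Vector_Spaces.linear scale scale (\<rho> (W 0))"
    using assms(2) by (simp add: bilinear_map_def)
  have diag: "\<rho> (W 0) (W n) = scale (l n) (W n)" for n
  proof -
    have "l n = - \<phi> 0 n" using phi_zero_left[of n] by (simp add: l_def)
    then show ?thesis by (simp add: \<rho> circ_graded)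
  qed
  note basis = W_inj W_independent W_span lin diag l
  have "is_direct_sum (weight_space W scale \<rho>)"
    using is_direct_sum_eigenspaces_diagonal[OF basis] by (simp add: weight_space_def[abs_def])
  moreover have "\<rho> (bracket x y) v = \<rho> x (\<rho> y v) - \<rho> y (\<rho> x v)" for x y v
  proof -
    \<comment> \<open>The signs cancel in \<open>\<rho> x (\<rho> y v)\<close>, but one survives in
      \<open>\<rho> (bracket x y) v\<close>; it undoes the reversed commutator of
      \<open>anti_pre_lie\<close>.\<close>
    have "circ y (circ x v) - circ x (circ y v) = circ (bracket x y) v"
      by (simp add: anti_pre_lie bracket_eq_commutator)
    then show ?thesis by (simp add: \<rho> circ_neg algebra_simps)
  qed
  ultimately have "witt_weight_representation scale bracket W scale \<rho>"
    using assms(2) by unfold_locales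
  moreover have "dim (weight_space W scale \<rho> \<mu>) = 1"
    if "weight_space W scale \<rho> \<mu> \<noteq> {0}" for \<mu>
  proof -
    have "\<mu> \<in> range l"
      using that eigenspace_diagonal(2)[OF basis] by (auto simp: weight_space_def)
    then obtain n where "\<mu> = l n" by auto
    then have "weight_space W scale \<rho> \<mu> = span {W n}"
      using eigenspace_diagonal(1)[OF basis] by (simp add: weight_space_def)
    then show ?thesis
      by (simp add: dim_eq_card_independent W_nonzero)
  qed
  ultimately show ?thesis by blast
qed

end
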